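(* Let $\mathbf A$ be a representable distributive quasi relation algebra with representation data $(X_{\mathbf A},\leqslant_{X_{\mathbf A}})$, $E_{\mathbf A}$, $\alpha_{\mathbf A}$, $\beta_{\mathbf A}$, $\varphi$, let $p$ be a positive symmetric idempotent of $\mathbf A$, and let $X_{\mathbf A}/{\equiv}$, $\leqslant_{X_{\mathbf A}/{\equiv}}$, $E_{p\mathbf Ap}$, $\alpha_{p\mathbf Ap}$, $\beta_{p\mathbf Ap}$ be as in the context. Let $\preccurlyeq_{E_{p\mathbf Ap}}$ be the order on $E_{p\mathbf Ap}$ given by $([u],[v])\preccurlyeq([x],[y])$ iff $[x]\leqslant_{X_{\mathbf A}/{\equiv}}[u]$ and $[v]\leqslant_{X_{\mathbf A}/{\equiv}}[y]$. Then the algebra $\langle \mathsf{Up}(E_{p\mathbf Ap},\preccurlyeq_{E_{p\mathbf Ap}}),\cap,\cup,;,{\sim},-,\neg,\leqslant_{X_{\mathbf A}/{\equiv}}\rangle$, where ${\sim}R=R^{c\smile};\alpha_{p\mathbf Ap}$, $-R=\alpha_{p\mathbf Ap};R^{c\smile}$, $\neg R=\alpha_{p\mathbf Ap};\beta_{p\mathbf Ap};R^c;\beta_{p\mathbf Ap}$ and complements are taken relative to $E_{p\mathbf Ap}$, is a distributive quasi relation algebra.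
   Context: A quasi relation algebra (qRA) is an algebra $\mathbf A=\langle A,\wedge,\vee,\cdot,{\sim},-,\neg,1\rangle$ such that $\langle A,\wedge,\vee\rangle$ is a lattice, $\langle A,\cdot,1\rangle$ is a monoid, and for all $a,b,c$: $ab\leqslant c$ iff $a\leqslant -(b\cdot{\sim}c)$ iff $b\leqslant {\sim}(-c\cdot a)$; ${\sim}{-}a=a={-}{\sim}a$; $\neg\neg a=a$; $\neg(a\vee b)=\neg a\wedge\neg b$; $\neg(ab)=\neg a+\neg b$ where $a+b:={\sim}(-a\cdot-b)$. It is distributive (a DqRA) if its lattice reduct is distributive. An element $p$ is positive if $1\leqslant p$, symmetric if ${\sim}p=-p=\neg p$, idempotent if $pp=p$. Relational notation: for an equivalence relation $E$ on a set $X$ and $R,S\subseteq X^2$, $R^{\smile}=\{(y,x)\mid (x,y)\in R\}$, $R^c=\{(x,y)\in E\mid (x,y)\notin R\}$, $R;S=\{(x,y)\mid \exists z\,((x,z)\in R,(z,y)\in S)\}$; a function $\gamma:X\to X$ is identified with its graph $\{(x,\gamma(x))\}$. Given a poset $(X,\leqslant)$, an equivalence relation $E$ on $X$ with ${\leqslant}\subseteq E$, an order automorphism $\alpha$ and a self-inverse dual order automorphism $\beta$ of $(X,\leqslant)$ with $\alpha,\beta\subseteq E$ and $\alpha;\beta;\alpha=\beta$, order $E$ by $(u,v)\preccurlyeq(x,y)$ iff $x\leqslant u$ and $v\leqslant y$, and let $\mathsf{Up}(E)$ be the set of up-sets of $(E,\preccurlyeq)$; $\mathbf{Dq}(E)=\langle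 \mathsf{Up}(E),\cap,\cup,;,{\sim},-,\neg,\leqslant\rangle$ with ${\sim}R=R^{c\smile};\alpha$, $-R=\alpha;R^{c\smile}$, $\neg R=\alpha;\beta;R^c;\beta$. A DqRA $\mathbf A$ is representable if there exist such data $(X_{\mathbf A},\leqslant_{X_{\mathbf A}})$, $E_{\mathbf A}$, $\alpha_{\mathbf A}$, $\beta_{\mathbf A}$ and an injective homomorphism $\varphi:\mathbf A\to\mathbf{Dq}(E_{\mathbf A})$. Quotient construction: for a positive symmetric idempotent $p$, $\varphi(p)$ is a preorder on $X_{\mathbf A}$ containing $\leqslant_{X_{\mathbf A}}$ and contained in $E_{\mathbf A}$. Define $x\equiv y$ iff $(x,y)\in\varphi(p)$ and $(y,x)\in\varphi(p)$, write $[x]$ for the class of $x$ and $X_{\mathbf A}/{\equiv}$ for the set of classes; $[x]\leqslant_{X_{\mathbf A}/{\equiv}}[y]$ iff $(x,y)\in\varphi(p)$; $([x],[y])\in E_{p\mathbf Ap}$ iff $(x,y)\in E_{\mathbf A}$; $\alpha_{p\mathbf Ap}([x])=[\alpha_{\mathbf A}(x)]$, $\beta_{p\mathbf Ap}([x])=[\beta_{\mathbf A}(x)]$.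
   Formalization: The sum in the quasi relation algebra axiom ¬(ab)=¬a+¬b is taken as a+b := ~(-b·-a) instead of the printed ~(-a·-b), for both the given algebra and the conclusion; with the printed order the claim fails, e.g. for all binary relations on a two-element set. *)

theory Defs
  imports Main
begin

record 'a qra =
  qcarrier :: "'a set"
  qmeet :: "'a \<Rightarrow> 'a \<Rightarrow> 'a"
  qjoin :: "'a \<Rightarrow> 'a \<Rightarrow> 'a"
  qmult :: "'a \<Rightarrow> 'a \<Rightarrow> 'a"
  qtilde :: "'a \<Rightarrow> 'a"
  qminus :: "'a \<Rightarrow> 'a"
  qneg :: "'a \<Rightarrow> 'a"
  qone :: "'a"

definition qle :: "('a, 'm) qra_scheme \<Rightarrow> 'a \<Rightarrow> 'a \<Rightarrow> bool" where
  "qle A a b \<longleftrightarrow> qmeet A a b = a"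

text \<open>The order of the two factors matters: in the algebras \<open>Dq\<close> below,
  \<open>\<sim>(-b \<cdot> -a)\<close> is \<open>(a\<^sup>c ; \<alpha>\<^sup>-\<^sup>1 ; b\<^sup>c)\<^sup>c\<close>, and with this reading
  \<open>\<not>(a \<cdot> b) = \<not>a + \<not>b\<close> holds there. With \<open>\<sim>(-a \<cdot> -b)\<close> instead, that
  equation would force multiplication to be commutative.\<close>

definition qplus :: "('a, 'm) qra_scheme \<Rightarrow> 'a \<Rightarrow> 'a \<Rightarrow> 'a" where
  "qplus A a b = qtilde A (qmult A (qminus A b) (qminus A a))"

definition qra_closed :: "('a, 'm) qra_scheme \<Rightarrow> bool" where
  "qra_closed A \<longleftrightarrow>
     qone A \<in> qcarrier A \<and>
     (\<forall>a\<in>qcarrier A. qtilde A a \<in> qcarrier A \<and> qminus A a \<in> qcarrier A \<and> qneg A a \<in> qcarrier A) \<and>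
     (\<forall>a\<in>qcarrier A. \<forall>b\<in>qcarrier A.
        qmeet A a b \<in> qcarrier A \<and> qjoin A a b \<in> qcarrier A \<and> qmult A a b \<in> qcarrier A)"

definition qra_lattice :: "('a, 'm) qra_scheme \<Rightarrow> bool" where
  "qra_lattice A \<longleftrightarrow>
     (\<forall>a\<in>qcarrier A. \<forall>b\<in>qcarrier A.
        qmeet A a b = qmeet A b a \<and> qjoin A a b = qjoin A b a \<and>
        qmeet A a (qjoin A a b) = a \<and> qjoin A a (qmeet A a b) = a) \<and>
     (\<forall>a\<in>qcarrier A. \<forall>b\<in>qcarrier A. \<forall>c\<in>qcarrier A.
        qmeet A (qmeet A a b) c = qmeet A a (qmeet A b c) \<and>
        qjoin A (qjoin A a b) c = qjoin A a (qjoin A b c))"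

definition qra_monoid :: "('a, 'm) qra_scheme \<Rightarrow> bool" where
  "qra_monoid A \<longleftrightarrow>
     (\<forall>a\<in>qcarrier A. qmult A (qone A) a = a \<and> qmult A a (qone A) = a) \<and>
     (\<forall>a\<in>qcarrier A. \<forall>b\<in>qcarrier A. \<forall>c\<in>qcarrier A.
        qmult A (qmult A a b) c = qmult A a (qmult A b c))"

definition quasi_relation_algebra :: "('a, 'm) qra_scheme \<Rightarrow> bool" where
  "quasi_relation_algebra A \<longleftrightarrow>
     qra_closed A \<and> qra_lattice A \<and> qra_monoid A \<and>
     (\<forall>a\<in>qcarrier A. \<forall>b\<in>qcarrier A. \<forall>c\<in>qcarrier A.
        (qle A (qmult A a b) c \<longleftrightarrow> qle A a (qminus A (qmult A b (qtilde A c)))) \<and>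
        (qle A (qmult A a b) c \<longleftrightarrow> qle A b (qtilde A (qmult A (qminus A c) a)))) \<and>
     (\<forall>a\<in>qcarrier A.
        qtilde A (qminus A a) = a \<and> qminus A (qtilde A a) = a \<and> qneg A (qneg A a) = a) \<and>
     (\<forall>a\<in>qcarrier A. \<forall>b\<in>qcarrier A.
        qneg A (qjoin A a b) = qmeet A (qneg A a) (qneg A b) \<and>
        qneg A (qmult A a b) = qplus A (qneg A a) (qneg A b))"

definition DqRA :: "('a, 'm) qra_scheme \<Rightarrow> bool" where
  "DqRA A \<longleftrightarrow>
     quasi_relation_algebra A \<and>
     (\<forall>a\<in>qcarrier A. \<forall>b\<in>qcarrier A. \<forall>c\<in>qcarrier A.
        qmeet A a (qjoin A b c) = qjoin A (qmeet A a b) (qmeet A a c))"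

definition qra_positive :: "('a, 'm) qra_scheme \<Rightarrow> 'a \<Rightarrow> bool" where
  "qra_positive A p \<longleftrightarrow> qle A (qone A) p"

definition qra_symmetric :: "('a, 'm) qra_scheme \<Rightarrow> 'a \<Rightarrow> bool" where
  "qra_symmetric A p \<longleftrightarrow> qtilde A p = qminus A p \<and> qminus A p = qneg A p"

definition qra_idempotent :: "('a, 'm) qra_scheme \<Rightarrow> 'a \<Rightarrow> bool" where
  "qra_idempotent A p \<longleftrightarrow> qmult A p p = p"

definition qra_hom :: "('a, 'm) qra_scheme \<Rightarrow> ('b, 'n) qra_scheme \<Rightarrow> ('a \<Rightarrow> 'b) \<Rightarrow> bool" where
  "qra_hom A B h \<longleftrightarrow>
     h ` qcarrier A \<subseteq> qcarrier B \<and>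
     h (qone A) = qone B \<and>
     (\<forall>a\<in>qcarrier A.
        h (qtilde A a) = qtilde B (h a) \<and> h (qminus A a) = qminus B (h a) \<and>
        h (qneg A a) = qneg B (h a)) \<and>
     (\<forall>a\<in>qcarrier A. \<forall>b\<in>qcarrier A.
        h (qmeet A a b) = qmeet B (h a) (h b) \<and> h (qjoin A a b) = qjoin B (h a) (h b) \<and>
        h (qmult A a b) = qmult B (h a) (h b))"

definition fun_graph :: "'x set \<Rightarrow> ('x \<Rightarrow> 'x) \<Rightarrow> 'x rel" where
  "fun_graph X f = {(x, f x) | x. x \<in> X}"

definition order_automorphism :: "'x set \<Rightarrow> 'x rel \<Rightarrow> ('x \<Rightarrow> 'x) \<Rightarrow> bool" where
  "order_automorphism X le f \<longleftrightarrow>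
     bij_betw f X X \<and> (\<forall>x\<in>X. \<forall>y\<in>X. (x, y) \<in> le \<longleftrightarrow> (f x, f y) \<in> le)"

definition dual_order_automorphism :: "'x set \<Rightarrow> 'x rel \<Rightarrow> ('x \<Rightarrow> 'x) \<Rightarrow> bool" where
  "dual_order_automorphism X le f \<longleftrightarrow>
     bij_betw f X X \<and> (\<forall>x\<in>X. \<forall>y\<in>X. (x, y) \<in> le \<longleftrightarrow> (f y, f x) \<in> le)"

definition pair_order :: "'x rel \<Rightarrow> 'x rel \<Rightarrow> ('x \<times> 'x) rel" where
  "pair_order le E =
     {((u, v), (x, y)) | u v x y. (u, v) \<in> E \<and> (x, y) \<in> E \<and> (x, u) \<in> le \<and> (v, y) \<in> le}"

definition up_sets :: "'b set \<Rightarrow> 'b rel \<Rightarrow> 'b set set" where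
  "up_sets P r = {U. U \<subseteq> P \<and> (\<forall>a\<in>U. \<forall>b\<in>P. (a, b) \<in> r \<longrightarrow> b \<in> U)}"

definition Dq ::
  "'x set \<Rightarrow> 'x rel \<Rightarrow> 'x rel \<Rightarrow> ('x \<Rightarrow> 'x) \<Rightarrow> ('x \<Rightarrow> 'x) \<Rightarrow> 'x rel qra" where
  "Dq X le E \<alpha> \<beta> =
     \<lparr>qcarrier = up_sets E (pair_order le E),
      qmeet = (\<inter>),
      qjoin = (\<union>),
      qmult = (O),
      qtilde = (\<lambda>R. (E - R)\<inverse> O fun_graph X \<alpha>),
      qminus = (\<lambda>R. fun_graph X \<alpha> O (E - R)\<inverse>),
      qneg = (\<lambda>R. fun_graph X \<alpha> O fun_graph X \<beta> O (E - R) O fun_graph X \<beta>),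
      qone = le\<rparr>"

definition Dq_data ::
  "'x set \<Rightarrow> 'x rel \<Rightarrow> 'x rel \<Rightarrow> ('x \<Rightarrow> 'x) \<Rightarrow> ('x \<Rightarrow> 'x) \<Rightarrow> bool" where
  "Dq_data X le E \<alpha> \<beta> \<longleftrightarrow>
     partial_order_on X le \<and> equiv X E \<and> le \<subseteq> E \<and>
     order_automorphism X le \<alpha> \<and>
     dual_order_automorphism X le \<beta> \<and> (\<forall>x\<in>X. \<beta> (\<beta> x) = x) \<and>
     fun_graph X \<alpha> \<subseteq> E \<and> fun_graph X \<beta> \<subseteq> E \<and>
     fun_graph X \<alpha> O fun_graph X \<beta> O fun_graph X \<alpha> = fun_graph X \<beta>"

definition qra_representation ::
  "('a, 'm) qra_scheme \<Rightarrow> 'x set \<Rightarrow> 'x rel \<Rightarrow> 'x rel \<Rightarrow> ('x \<Rightarrow> 'x) \<Rightarrow> ('x \<Rightarrow> 'x) \<Rightarrow>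
     ('a \<Rightarrow> 'x rel) \<Rightarrow> bool" where
  "qra_representation A X le E \<alpha> \<beta> \<phi> \<longleftrightarrow>
     Dq_data X le E \<alpha> \<beta> \<and> qra_hom A (Dq X le E \<alpha> \<beta>) \<phi> \<and> inj_on \<phi> (qcarrier A)"

text \<open>In the following, \<open>Q\<close> is a preorder on \<open>X\<close>; it will be \<open>\<phi> p\<close>. The
  elements of \<open>X\<close> modulo the equivalence are \<open>X // preorder_equiv Q\<close>.\<close>

definition preorder_equiv :: "'x rel \<Rightarrow> 'x rel" where
  "preorder_equiv Q = {(x, y). (x, y) \<in> Q \<and> (y, x) \<in> Q}"

definition eq_class :: "'x rel \<Rightarrow> 'x \<Rightarrow> 'x set" where
  "eq_class Q x = preorder_equiv Q `` {x}"

definition quot_rel :: "'x rel \<Rightarrow> 'x rel \<Rightarrow> 'x set rel" where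
  "quot_rel Q R = {(eq_class Q x, eq_class Q y) | x y. (x, y) \<in> R}"

text \<open>The map \<open>[x] \<mapsto> [f x]\<close>: when \<open>f\<close> respects the equivalence, the union is over
  copies of one and the same class; see \<open>quot_well_defined\<close>.\<close>

definition quot_map :: "'x rel \<Rightarrow> ('x \<Rightarrow> 'x) \<Rightarrow> 'x set \<Rightarrow> 'x set" where
  "quot_map Q f C = (\<Union>x\<in>C. eq_class Q (f x))"

lemma representation_invariance:
  assumes r: "qra_representation A X le E \<alpha> \<beta> \<phi>" and pA: "p \<in> qcarrier A"
    and pos: "qra_positive A p" and symm: "qra_symmetric A p"
    and idem: "qra_idempotent A p" and one: "qone A \<in> qcarrier A"
  shows "preorder_on X (\<phi> p)" "le \<subseteq> \<phi> p" "\<phi> p \<subseteq> E"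
    and "\<And>x y. x \<in> X \<Longrightarrow> y \<in> X \<Longrightarrow> (\<alpha> x, \<alpha> y) \<in> \<phi> p \<longleftrightarrow> (x, y) \<in> \<phi> p"
    and "\<And>x y. x \<in> X \<Longrightarrow> y \<in> X \<Longrightarrow> (\<beta> y, \<beta> x) \<in> \<phi> p \<longleftrightarrow> (x, y) \<in> \<phi> p"
proof -
  let ?Q = "\<phi> p"
  have D: "Dq_data X le E \<alpha> \<beta>" and h: "qra_hom A (Dq X le E \<alpha> \<beta>) \<phi>"
    using r unfolding qra_representation_def by auto
  have po: "partial_order_on X le" and eq: "equiv X E" and leE: "le \<subseteq> E"
    and ba: "bij_betw \<alpha> X X" and bb: "bij_betw \<beta> X X" and bbb: "\<And>x. x \<in> X \<Longrightarrow> \<beta> (\<beta> x) = x"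
    and aE: "\<And>x. x \<in> X \<Longrightarrow> (x, \<alpha> x) \<in> E" and bE: "\<And>x. x \<in> X \<Longrightarrow> (x, \<beta> x) \<in> E"
    using D unfolding Dq_data_def order_automorphism_def dual_order_automorphism_def fun_graph_def by auto
  have QE: "?Q \<subseteq> E" using h pA unfolding qra_hom_def Dq_def up_sets_def by auto
  have "\<phi> (qmeet A (qone A) p) = le \<inter> ?Q" "\<phi> (qone A) = le" "\<phi> (qmult A p p) = ?Q O ?Q"
    using h pA one unfolding qra_hom_def Dq_def by auto
  then have leQ: "le \<subseteq> ?Q" and QQ: "?Q O ?Q = ?Q"
    using pos idem unfolding qra_positive_def qra_idempotent_def qle_def by auto
  have EX: "E \<subseteq> X \<times> X" using eq unfolding equiv_def by auto
  have rl: "refl_on X le" using po unfolding partial_order_on_def preorder_on_def by auto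
  show "preorder_on X ?Q" "le \<subseteq> ?Q" "?Q \<subseteq> E"
    using QQ leQ QE EX rl unfolding preorder_on_def refl_on_def trans_def by blast+
  have "\<phi> (qtilde A p) = (E - ?Q)\<inverse> O fun_graph X \<alpha>"
    "\<phi> (qminus A p) = fun_graph X \<alpha> O (E - ?Q)\<inverse>"
    "\<phi> (qneg A p) = fun_graph X \<alpha> O fun_graph X \<beta> O (E - ?Q) O fun_graph X \<beta>"
    using h pA unfolding qra_hom_def Dq_def by simp_all
  then have sy: "(E - ?Q)\<inverse> O fun_graph X \<alpha> = fun_graph X \<alpha> O (E - ?Q)\<inverse> \<and>
      fun_graph X \<alpha> O (E - ?Q)\<inverse> = fun_graph X \<alpha> O fun_graph X \<beta> O (E - ?Q) O fun_graph X \<beta>"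
    using symm unfolding qra_symmetric_def by metis
  have s1: "(E - ?Q)\<inverse> O fun_graph X \<alpha> = fun_graph X \<alpha> O (E - ?Q)\<inverse>"
    and s2: "fun_graph X \<alpha> O (E - ?Q)\<inverse> = fun_graph X \<alpha> O fun_graph X \<beta> O (E - ?Q) O fun_graph X \<beta>"
    using sy by simp_all
  have Esym: "\<And>x y. (x,y) \<in> E \<Longrightarrow> (y,x) \<in> E" and Etr: "\<And>x y z. (x,y) \<in> E \<Longrightarrow> (y,z) \<in> E \<Longrightarrow> (x,z) \<in> E"
    using eq unfolding equiv_def sym_def trans_def by blast+
  have aX: "\<And>x. x \<in> X \<Longrightarrow> \<alpha> x \<in> X" and bX: "\<And>x. x \<in> X \<Longrightarrow> \<beta> x \<in> X" 
    using ba bb by (auto simp: bij_betw_def)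
  have ai: "\<And>x y. x \<in> X \<Longrightarrow> y \<in> X \<Longrightarrow> \<alpha> x = \<alpha> y \<longleftrightarrow> x = y" using ba by (auto simp: bij_betw_def inj_on_def)
  have aE2: "(\<alpha> x, \<alpha> y) \<in> E \<longleftrightarrow> (x,y) \<in> E" if "x \<in> X" "y \<in> X" for x y
    using that aE Esym Etr by meson
  have bE2: "(\<beta> y, \<beta> x) \<in> E \<longleftrightarrow> (x,y) \<in> E" if "x \<in> X" "y \<in> X" for x y
    using that bE Esym Etr by meson
  show "(\<alpha> x, \<alpha> y) \<in> ?Q \<longleftrightarrow> (x, y) \<in> ?Q" if xy: "x \<in> X" "y \<in> X" for x y
  proof -
    have "(y, \<alpha> x) \<in> (E - ?Q)\<inverse> O fun_graph X \<alpha> \<longleftrightarrow> (x, y) \<in> E - ?Q"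
      using xy EX ai unfolding fun_graph_def by auto
    moreover have "(y, \<alpha> x) \<in> fun_graph X \<alpha> O (E - ?Q)\<inverse> \<longleftrightarrow> (\<alpha> x, \<alpha> y) \<in> E - ?Q"
      using xy unfolding fun_graph_def by auto
    ultimately show ?thesis using s1 QE aE2[OF xy] by blast
  qed
  show "(\<beta> y, \<beta> x) \<in> ?Q \<longleftrightarrow> (x, y) \<in> ?Q" if xy: "x \<in> X" "y \<in> X" for x y
  proof -
    obtain w where w: "w \<in> X" "\<alpha> w = y" using ba xy by (metis bij_betw_imp_surj_on imageE)
    have "(w, x) \<in> fun_graph X \<alpha> O (E - ?Q)\<inverse> \<longleftrightarrow> (x, y) \<in> E - ?Q"
      using xy w unfolding fun_graph_def by auto
    moreover have "(w, x) \<in> fun_graph X \<alpha> O fun_graph X \<beta> O (E - ?Q) O fun_graph X \<beta> \<longleftrightarrow> (\<beta> y, \<beta> x) \<in> E - ?Q"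
    proof
      assume "(w, x) \<in> fun_graph X \<alpha> O fun_graph X \<beta> O (E - ?Q) O fun_graph X \<beta>"
      then show "(\<beta> y, \<beta> x) \<in> E - ?Q" using w bbb unfolding fun_graph_def by auto
    next
      assume a: "(\<beta> y, \<beta> x) \<in> E - ?Q"
      have "(w,y) \<in> fun_graph X \<alpha>" "(y, \<beta> y) \<in> fun_graph X \<beta>" "(\<beta> x, x) \<in> fun_graph X \<beta>"
        using w xy bX bbb unfolding fun_graph_def by force+
      then show "(w, x) \<in> fun_graph X \<alpha> O fun_graph X \<beta> O (E - ?Q) O fun_graph X \<beta>" using a by blast
    qed
    ultimately show ?thesis using s2 QE bE2[OF xy] by blast
  qed
qed

lemma quot_well_defined:
  assumes "DqRA A" and r: "qra_representation A X le E \<alpha> \<beta> \<phi>" and pA: "p \<in> qcarrier A"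
    and pos: "qra_positive A p" and symm: "qra_symmetric A p" and idem: "qra_idempotent A p"
    and xy: "x \<in> X" "y \<in> X"
  shows "eq_class (\<phi> p) x = eq_class (\<phi> p) y \<longleftrightarrow> (x, y) \<in> \<phi> p \<and> (y, x) \<in> \<phi> p"
    and "(eq_class (\<phi> p) x, eq_class (\<phi> p) y) \<in> quot_rel (\<phi> p) (\<phi> p) \<longleftrightarrow> (x, y) \<in> \<phi> p"
    and "(eq_class (\<phi> p) x, eq_class (\<phi> p) y) \<in> quot_rel (\<phi> p) E \<longleftrightarrow> (x, y) \<in> E"
    and "quot_map (\<phi> p) \<alpha> (eq_class (\<phi> p) x) = eq_class (\<phi> p) (\<alpha> x)"
    and "quot_map (\<phi> p) \<beta> (eq_class (\<phi> p) x) = eq_class (\<phi> p) (\<beta> x)"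
proof -
  let ?Q = "\<phi> p"
  have one: "qone A \<in> qcarrier A"
    using assms(1) unfolding DqRA_def quasi_relation_algebra_def qra_closed_def by blast
  note inv = representation_invariance[OF r pA pos symm idem one]
  have Qr: "\<And>x. x \<in> X \<Longrightarrow> (x, x) \<in> ?Q" and QX: "?Q \<subseteq> X \<times> X"
    and Qt: "\<And>x y z. (x, y) \<in> ?Q \<Longrightarrow> (y, z) \<in> ?Q \<Longrightarrow> (x, z) \<in> ?Q"
    using inv(1) unfolding preorder_on_def refl_on_def trans_def by blast+
  have eq: "equiv X E" and aX: "\<And>x. x \<in> X \<Longrightarrow> \<alpha> x \<in> X" and bX: "\<And>x. x \<in> X \<Longrightarrow> \<beta> x \<in> X"
    using r unfolding qra_representation_def Dq_data_def order_automorphism_def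
      dual_order_automorphism_def bij_betw_def by auto
  have EX: "E \<subseteq> X \<times> X" and Esym: "\<And>x y. (x, y) \<in> E \<Longrightarrow> (y, x) \<in> E"
    and Etr: "\<And>x y z. (x, y) \<in> E \<Longrightarrow> (y, z) \<in> E \<Longrightarrow> (x, z) \<in> E"
    using eq unfolding equiv_def sym_def trans_def by blast+
  have cl: "eq_class ?Q u = eq_class ?Q v \<longleftrightarrow> (u, v) \<in> ?Q \<and> (v, u) \<in> ?Q"
    if "u \<in> X" "v \<in> X" for u v
  proof
    assume "eq_class ?Q u = eq_class ?Q v"
    moreover have "v \<in> eq_class ?Q v"
      using Qr[OF that(2)] unfolding eq_class_def preorder_equiv_def by simp
    ultimately show "(u, v) \<in> ?Q \<and> (v, u) \<in> ?Q"
      unfolding eq_class_def preorder_equiv_def by auto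
  next
    assume "(u, v) \<in> ?Q \<and> (v, u) \<in> ?Q"
    then show "eq_class ?Q u = eq_class ?Q v"
      unfolding eq_class_def preorder_equiv_def by (auto intro: Qt)
  qed
  show "eq_class ?Q x = eq_class ?Q y \<longleftrightarrow> (x, y) \<in> ?Q \<and> (y, x) \<in> ?Q"
    by (rule cl[OF xy])
  show "(eq_class ?Q x, eq_class ?Q y) \<in> quot_rel ?Q ?Q \<longleftrightarrow> (x, y) \<in> ?Q"
  proof
    assume "(eq_class ?Q x, eq_class ?Q y) \<in> quot_rel ?Q ?Q"
    then obtain u v where uv: "eq_class ?Q x = eq_class ?Q u" "eq_class ?Q y = eq_class ?Q v" "(u, v) \<in> ?Q"
      unfolding quot_rel_def by blast
    then have "u \<in> X" "v \<in> X" using QX by auto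
    then have "(x, u) \<in> ?Q" "(v, y) \<in> ?Q" using uv cl xy by blast+
    then show "(x, y) \<in> ?Q" using uv(3) Qt by blast
  qed (auto simp: quot_rel_def)
  show "(eq_class ?Q x, eq_class ?Q y) \<in> quot_rel ?Q E \<longleftrightarrow> (x, y) \<in> E"
  proof
    assume "(eq_class ?Q x, eq_class ?Q y) \<in> quot_rel ?Q E"
    then obtain u v where uv: "eq_class ?Q x = eq_class ?Q u" "eq_class ?Q y = eq_class ?Q v" "(u, v) \<in> E"
      unfolding quot_rel_def by blast
    then have "u \<in> X" "v \<in> X" using EX by auto
    then have "(x, u) \<in> E" "(v, y) \<in> E" using uv cl xy inv(3) by blast+
    then show "(x, y) \<in> E" using uv(3) Etr by blast
  qed (auto simp: quot_rel_def)
  have xx: "x \<in> eq_class ?Q x"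
    using Qr[OF xy(1)] unfolding eq_class_def preorder_equiv_def by simp
  have mem: "z \<in> X \<and> (x, z) \<in> ?Q \<and> (z, x) \<in> ?Q" if "z \<in> eq_class ?Q x" for z
    using that QX unfolding eq_class_def preorder_equiv_def by auto
  have "eq_class ?Q (\<alpha> z) = eq_class ?Q (\<alpha> x)" if "z \<in> eq_class ?Q x" for z
    using mem[OF that] cl aX inv(4) xy(1) by simp
  then show "quot_map ?Q \<alpha> (eq_class ?Q x) = eq_class ?Q (\<alpha> x)"
    using xx unfolding quot_map_def by blast
  have "eq_class ?Q (\<beta> z) = eq_class ?Q (\<beta> x)" if "z \<in> eq_class ?Q x" for z
    using mem[OF that] cl bX inv(5) xy(1) by simp
  then show "quot_map ?Q \<beta> (eq_class ?Q x) = eq_class ?Q (\<beta> x)"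
    using xx unfolding quot_map_def by blast
qed

end

theory Submission
  imports Defs
begin

text \<open>The quotient data are again representation data: \<open>\<phi> p\<close> is a preorder that \<open>\<alpha>\<close>
  preserves and \<open>\<beta>\<close> reverses, so it becomes a partial order on the classes. It then suffices
  that \<open>Dq\<close> of arbitrary data is a distributive quasi relation algebra. For pairs in \<open>E\<close> the
  three unary operations are negated substitutions, \<open>(x, y) \<in> \<sim>R\<close> iff \<open>(\<alpha>\<^sup>-\<^sup>1 y, x) \<notin> R\<close>,
  \<open>(x, y) \<in> -R\<close> iff \<open>(y, \<alpha> x) \<notin> R\<close>, and \<open>(x, y) \<in> \<not>R\<close> iff \<open>(\<beta> (\<alpha> x), \<beta> y) \<notin> R\<close>,
  and every axiom is checked pointwise.\<close>

section \<open>Elementary consequences of the representation data\<close>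

locale Dq_frame =
  fixes X :: "'x set" and le E :: "'x rel" and \<alpha> \<beta> :: "'x \<Rightarrow> 'x"
  assumes data: "Dq_data X le E \<alpha> \<beta>"
begin

definition \<alpha>' :: "'x \<Rightarrow> 'x" where "\<alpha>' = inv_into X \<alpha>"

text \<open>Named copies of the unary operations of \<open>Dq\<close>, so that later rewriting uses
  membership rules instead of unfolding relational composites.\<close>

definition tld :: "'x rel \<Rightarrow> 'x rel" where "tld R = (E - R)\<inverse> O fun_graph X \<alpha>"
definition mns :: "'x rel \<Rightarrow> 'x rel" where "mns R = fun_graph X \<alpha> O (E - R)\<inverse>"
definition ngt :: "'x rel \<Rightarrow> 'x rel" where
  "ngt R = fun_graph X \<alpha> O fun_graph X \<beta> O (E - R) O fun_graph X \<beta>"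

abbreviation Up :: "'x rel set" where "Up \<equiv> up_sets E (pair_order le E)"

lemma le_refl_on: "refl_on X le" and le_transitive: "trans le" and le_sub_E: "le \<subseteq> E"
  and E_equiv: "equiv X E"
  using data unfolding Dq_data_def partial_order_on_def preorder_on_def by simp_all

lemma le_refl: "x \<in> X \<Longrightarrow> (x, x) \<in> le"
  using le_refl_on by (rule refl_onD)

lemma le_trans: "(x, y) \<in> le \<Longrightarrow> (y, z) \<in> le \<Longrightarrow> (x, z) \<in> le"
  using le_transitive by (rule transD)

lemma le_E: "(x, y) \<in> le \<Longrightarrow> (x, y) \<in> E"
  using le_sub_E by (rule subsetD)

lemma E_refl: "x \<in> X \<Longrightarrow> (x, x) \<in> E"
  using E_equiv unfolding equiv_def refl_on_def by simp

lemma E_sym: "(x, y) \<in> E \<Longrightarrow> (y, x) \<in> E"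
  using E_equiv unfolding equiv_def by (blast dest: symD)

lemma E_trans: "(x, y) \<in> E \<Longrightarrow> (y, z) \<in> E \<Longrightarrow> (x, z) \<in> E"
  using E_equiv unfolding equiv_def by (blast dest: transD)

lemma E_left: "(x, y) \<in> E \<Longrightarrow> x \<in> X" and E_right: "(x, y) \<in> E \<Longrightarrow> y \<in> X"
  using E_equiv unfolding equiv_def by auto

lemma E_commute: "(x, y) \<in> E \<longleftrightarrow> (y, x) \<in> E"
  using E_sym by blast

text \<open>Complements are relative to \<open>E\<close>, so all relations compared later lie inside
  \<open>E\<close>. Testing only pairs of \<open>E\<close> also supplies that both points are in
  \<open>X\<close>, which the rewrite rules for \<alpha>, \<beta> and \<open>\<alpha>'\<close>
  require.\<close>

lemma E_relation_eqI:
  assumes "R \<subseteq> E" "S \<subseteq> E"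
    and "\<And>x y. (x, y) \<in> E \<Longrightarrow> x \<in> X \<Longrightarrow> y \<in> X \<Longrightarrow> (x, y) \<in> R \<longleftrightarrow> (x, y) \<in> S"
  shows "R = S"
  using assms E_left E_right by (intro equalityI subrelI) blast+

lemma \<alpha>_automorphism: "order_automorphism X le \<alpha>"
  and \<beta>_automorphism: "dual_order_automorphism X le \<beta>"
  and \<beta>_\<beta>: "x \<in> X \<Longrightarrow> \<beta> (\<beta> x) = x"
  and \<alpha>_sub_E: "fun_graph X \<alpha> \<subseteq> E" and \<beta>_sub_E: "fun_graph X \<beta> \<subseteq> E"
  using data unfolding Dq_data_def by simp_all

lemma \<alpha>_bij: "bij_betw \<alpha> X X"
  and \<alpha>_le: "x \<in> X \<Longrightarrow> y \<in> X \<Longrightarrow> (\<alpha> x, \<alpha> y) \<in> le \<longleftrightarrow> (x, y) \<in> le"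
  using \<alpha>_automorphism unfolding order_automorphism_def by simp_all

lemma \<beta>_bij: "bij_betw \<beta> X X"
  and \<beta>_le: "x \<in> X \<Longrightarrow> y \<in> X \<Longrightarrow> (\<beta> x, \<beta> y) \<in> le \<longleftrightarrow> (y, x) \<in> le"
  using \<beta>_automorphism unfolding dual_order_automorphism_def by simp_all

lemma \<alpha>_E: "x \<in> X \<Longrightarrow> (x, \<alpha> x) \<in> E" and \<beta>_E: "x \<in> X \<Longrightarrow> (x, \<beta> x) \<in> E"
  using \<alpha>_sub_E \<beta>_sub_E unfolding fun_graph_def by auto

lemma \<alpha>_X: "x \<in> X \<Longrightarrow> \<alpha> x \<in> X" and \<beta>_X: "x \<in> X \<Longrightarrow> \<beta> x \<in> X"
  and \<alpha>'_X: "x \<in> X \<Longrightarrow> \<alpha>' x \<in> X"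
  and \<alpha>_\<alpha>': "x \<in> X \<Longrightarrow> \<alpha> (\<alpha>' x) = x" and \<alpha>'_\<alpha>: "x \<in> X \<Longrightarrow> \<alpha>' (\<alpha> x) = x"
  using \<alpha>_bij \<beta>_bij unfolding \<alpha>'_def bij_betw_def
  by (auto intro: inv_into_into f_inv_into_f inv_into_f_f)

text \<open>The data give an equation between graphs; the pair \<open>(x, \<beta> x)\<close> lies in
  its right side, and following the only path through the left side evaluates it.\<close>

lemma \<alpha>_\<beta>_\<alpha>: "\<alpha> (\<beta> (\<alpha> x)) = \<beta> x" if "x \<in> X"
proof -
  have "(x, \<beta> x) \<in> fun_graph X \<alpha> O fun_graph X \<beta> O fun_graph X \<alpha>"
    using data that unfolding Dq_data_def fun_graph_def by auto
  then show ?thesis unfolding fun_graph_def by auto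
qed

text \<open>Both maps move a point only within its \<open>E\<close>-class. Hence no substitution
  affects membership in \<open>E\<close>, and this clause separates from the rest of each
  operation.\<close>

lemma \<alpha>_E_left: "x \<in> X \<Longrightarrow> (\<alpha> x, y) \<in> E \<longleftrightarrow> (x, y) \<in> E"
  and \<alpha>_E_right: "x \<in> X \<Longrightarrow> (y, \<alpha> x) \<in> E \<longleftrightarrow> (y, x) \<in> E"
  and \<beta>_E_left: "x \<in> X \<Longrightarrow> (\<beta> x, y) \<in> E \<longleftrightarrow> (x, y) \<in> E"
  and \<beta>_E_right: "x \<in> X \<Longrightarrow> (y, \<beta> x) \<in> E \<longleftrightarrow> (y, x) \<in> E"
  using \<alpha>_E \<beta>_E E_sym E_trans by blast+

lemma \<alpha>'_E_left: "x \<in> X \<Longrightarrow> (\<alpha>' x, y) \<in> E \<longleftrightarrow> (x, y) \<in> E"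
  and \<alpha>'_E_right: "x \<in> X \<Longrightarrow> (y, \<alpha>' x) \<in> E \<longleftrightarrow> (y, x) \<in> E"
  by (metis \<alpha>_E_left \<alpha>'_X \<alpha>_\<alpha>') (metis \<alpha>_E_right \<alpha>'_X \<alpha>_\<alpha>')

lemma \<alpha>'_le: "x \<in> X \<Longrightarrow> y \<in> X \<Longrightarrow> (\<alpha>' x, \<alpha>' y) \<in> le \<longleftrightarrow> (x, y) \<in> le"
  by (metis \<alpha>_le \<alpha>'_X \<alpha>_\<alpha>')

lemmas E_shift = \<alpha>_E_left \<alpha>_E_right \<beta>_E_left \<beta>_E_right \<alpha>'_E_left \<alpha>'_E_right

section \<open>The unary operations as negated substitutions\<close>

lemma mem_tld: "(x, y) \<in> tld R \<longleftrightarrow> (x, y) \<in> E \<and> (\<alpha>' y, x) \<notin> R"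
proof
  assume "(x, y) \<in> tld R"
  then obtain z where z: "(z, x) \<in> E" "(z, x) \<notin> R" "y = \<alpha> z" "z \<in> X"
    unfolding tld_def fun_graph_def by auto
  then show "(x, y) \<in> E \<and> (\<alpha>' y, x) \<notin> R"
    by (simp add: \<alpha>'_\<alpha> E_shift E_commute)
next
  assume a: "(x, y) \<in> E \<and> (\<alpha>' y, x) \<notin> R"
  then have y: "y \<in> X" using E_right by blast
  \<comment> \<open>The composite must end with the step from \<open>\<alpha>' y\<close> to
    \<open>y\<close>, so \<open>\<alpha>' y\<close> is the only possible intermediate point.\<close>
  have "(\<alpha>' y, x) \<in> E - R" using a y by (simp add: E_shift E_commute)
  moreover have "(\<alpha>' y, y) \<in> fun_graph X \<alpha>"
    using y \<alpha>'_X \<alpha>_\<alpha>' unfolding fun_graph_def by force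
  ultimately show "(x, y) \<in> tld R" unfolding tld_def by blast
qed

lemma mem_mns: "(x, y) \<in> mns R \<longleftrightarrow> (x, y) \<in> E \<and> (y, \<alpha> x) \<notin> R"
proof
  assume "(x, y) \<in> mns R"
  then have "x \<in> X" "(y, \<alpha> x) \<in> E" "(y, \<alpha> x) \<notin> R" unfolding mns_def fun_graph_def by auto
  then show "(x, y) \<in> E \<and> (y, \<alpha> x) \<notin> R" by (simp add: E_shift E_commute)
next
  assume a: "(x, y) \<in> E \<and> (y, \<alpha> x) \<notin> R"
  then have "x \<in> X" using E_left by blast
  then show "(x, y) \<in> mns R"
    using a unfolding mns_def fun_graph_def by (auto simp: E_shift E_commute)
qed

lemma mem_ngt: "(x, y) \<in> ngt R \<longleftrightarrow> (x, y) \<in> E \<and> (\<beta> (\<alpha> x), \<beta> y) \<notin> R"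
proof
  assume "(x, y) \<in> ngt R"
  then obtain z where z: "(\<beta> (\<alpha> x), z) \<in> E" "(\<beta> (\<alpha> x), z) \<notin> R" "y = \<beta> z" "z \<in> X" "x \<in> X"
    unfolding ngt_def fun_graph_def by auto
  then show "(x, y) \<in> E \<and> (\<beta> (\<alpha> x), \<beta> y) \<notin> R"
    by (simp add: \<beta>_\<beta> \<alpha>_X E_shift)
next
  assume a: "(x, y) \<in> E \<and> (\<beta> (\<alpha> x), \<beta> y) \<notin> R"
  then have xy: "x \<in> X" "y \<in> X" using E_left E_right by blast+
  \<comment> \<open>The path runs through \<open>x\<close>, \<open>\<alpha> x\<close>,
    \<open>\<beta> (\<alpha> x)\<close>, \<open>\<beta> y\<close>, \<open>y\<close>; its last step
    is a \<beta>-step because \<beta> is self-inverse.\<close>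
  have "(\<beta> (\<alpha> x), \<beta> y) \<in> E - R" using a xy by (simp add: \<alpha>_X E_shift)
  moreover have "(x, \<alpha> x) \<in> fun_graph X \<alpha>" "(\<alpha> x, \<beta> (\<alpha> x)) \<in> fun_graph X \<beta>"
    "(\<beta> y, y) \<in> fun_graph X \<beta>"
    using xy \<alpha>_X \<beta>_X \<beta>_\<beta> unfolding fun_graph_def by force+
  ultimately show "(x, y) \<in> ngt R" unfolding ngt_def by blast
qed

section \<open>Closure of the up-sets under the operations\<close>

lemma le_E_le: "(x, u) \<in> le \<Longrightarrow> (u, v) \<in> E \<Longrightarrow> (v, y) \<in> le \<Longrightarrow> (x, y) \<in> E"
  using le_E E_trans by blast

lemma UpI:
  assumes "R \<subseteq> E"
    and "\<And>u v x y. (u, v) \<in> R \<Longrightarrow> (x, u) \<in> le \<Longrightarrow> (v, y) \<in> le \<Longrightarrow> (x, y) \<in> R"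
  shows "R \<in> Up"
  using assms unfolding up_sets_def pair_order_def by blast

lemma Up_E: "R \<in> Up \<Longrightarrow> (x, y) \<in> R \<Longrightarrow> (x, y) \<in> E"
  unfolding up_sets_def by blast

text \<open>Since \<open>le\<close> lies in the equivalence \<open>E\<close>, the target pair is in
  \<open>E\<close> automatically, which discharges the domain clause of
  \<open>pair_order\<close>.\<close>

lemma UpD: "(x, y) \<in> R"
  if R: "R \<in> Up" and uv: "(u, v) \<in> R" and xu: "(x, u) \<in> le" and vy: "(v, y) \<in> le"
proof -
  have "(u, v) \<in> E" using R uv by (rule Up_E)
  moreover from this have "(x, y) \<in> E" using le_E xu vy E_trans by blast
  ultimately have "((u, v), (x, y)) \<in> pair_order le E" "(x, y) \<in> E"
    using xu vy unfolding pair_order_def by blast+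
  then show ?thesis using R uv unfolding up_sets_def by blast
qed

lemma UpD_X:
  "R \<in> Up \<Longrightarrow> (x, y) \<in> R \<Longrightarrow> x \<in> X" "R \<in> Up \<Longrightarrow> (x, y) \<in> R \<Longrightarrow> y \<in> X"
  using Up_E E_left E_right by blast+

lemma le_Up: "le \<in> Up"
  by (rule UpI[OF le_sub_E]) (blast intro: le_trans)

lemma meet_Up: "R \<in> Up \<Longrightarrow> S \<in> Up \<Longrightarrow> R \<inter> S \<in> Up"
  and join_Up: "R \<in> Up \<Longrightarrow> S \<in> Up \<Longrightarrow> R \<union> S \<in> Up"
  unfolding up_sets_def by blast+

lemma comp_Up: "R O S \<in> Up" if "R \<in> Up" "S \<in> Up"
proof (rule UpI)
  show "R O S \<subseteq> E" using that Up_E E_trans by blast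
next
  fix u v x y assume "(u, v) \<in> R O S" and le: "(x, u) \<in> le" "(v, y) \<in> le"
  then obtain z where z: "(u, z) \<in> R" "(z, v) \<in> S" by blast
  \<comment> \<open>A reflexive step at the intermediate point lets each factor be enlarged on its
    outer side alone.\<close>
  then have "(z, z) \<in> le" using UpD_X that le_refl by blast
  then show "(x, y) \<in> R O S" using UpD that z le by blast
qed

text \<open>Complement turns up-sets into down-sets and converse turns them back; the substituted
  coordinate is harmless because \<open>\<alpha>'\<close> is monotone.\<close>

lemma tld_Up: "tld R \<in> Up" if "R \<in> Up"
proof (rule UpI)
  fix u v x y assume uv: "(u, v) \<in> tld R" and le: "(x, u) \<in> le" "(v, y) \<in> le"
  have "(x, y) \<in> E" using le_E_le[OF le(1) _ le(2)] uv by (simp add: mem_tld)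
  moreover have "(\<alpha>' v, \<alpha>' y) \<in> le" using le \<alpha>'_le le_E E_left E_right by blast
  ultimately show "(x, y) \<in> tld R" using uv UpD[OF that _ _ le(1)] unfolding mem_tld by blast
qed (use mem_tld in auto)

lemma mns_Up: "mns R \<in> Up" if "R \<in> Up"
proof (rule UpI)
  fix u v x y assume uv: "(u, v) \<in> mns R" and le: "(x, u) \<in> le" "(v, y) \<in> le"
  have "(x, y) \<in> E" using le_E_le[OF le(1) _ le(2)] uv by (simp add: mem_mns)
  moreover have "(\<alpha> x, \<alpha> u) \<in> le" using le \<alpha>_le le_E E_left E_right by blast
  ultimately show "(x, y) \<in> mns R" using uv UpD[OF that _ le(2)] unfolding mem_mns by blast
qed (use mem_mns in auto)

text \<open>No converse is present to undo the complement; instead \<beta> reverses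
  \<open>le\<close> in both coordinates.\<close>

lemma ngt_Up: "ngt R \<in> Up" if "R \<in> Up"
proof (rule UpI)
  fix u v x y assume uv: "(u, v) \<in> ngt R" and le: "(x, u) \<in> le" "(v, y) \<in> le"
  have "(x, y) \<in> E" using le_E_le[OF le(1) _ le(2)] uv by (simp add: mem_ngt)
  moreover have "(\<beta> (\<alpha> u), \<beta> (\<alpha> x)) \<in> le" "(\<beta> y, \<beta> v) \<in> le"
    using le le(1,2)[THEN le_E, THEN E_left] le(1,2)[THEN le_E, THEN E_right]
    by (simp_all add: \<beta>_le \<alpha>_le \<alpha>_X)
  ultimately show "(x, y) \<in> ngt R" using uv UpD[OF that] unfolding mem_ngt by blast
qed (use mem_ngt in auto)

section \<open>The algebraic laws on up-sets\<close>

lemma le_comp: "le O R = R" and comp_le: "R O le = R" if "R \<in> Up"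
proof -
  \<comment> \<open>Reflexivity serves twice: as the trivial step on the untouched side in
    \<open>UpD\<close>, and as the factor from \<open>le\<close> that puts \<open>R\<close> inside
    the composites.\<close>
  have refl: "(x, x) \<in> le" "(y, y) \<in> le" if "(x, y) \<in> R" for x y
    using UpD_X[OF \<open>R \<in> Up\<close> that] le_refl by blast+
  have "(x, z) \<in> R" if "(x, y) \<in> le" "(y, z) \<in> R" for x y z
    by (rule UpD[OF \<open>R \<in> Up\<close> that(2,1) refl(2)[OF that(2)]])
  then show "le O R = R" by (auto intro: refl)
  have "(x, z) \<in> R" if "(x, y) \<in> R" "(y, z) \<in> le" for x y z
    by (rule UpD[OF \<open>R \<in> Up\<close> that(1) refl(1)[OF that(1)] that(2)])
  then show "R O le = R" by (auto intro: refl)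
qed

lemma tld_mns: "tld (mns R) = R" if "R \<in> Up"
  by (rule E_relation_eqI)
    (use Up_E[OF that] in \<open>auto simp: mem_tld mem_mns E_shift E_commute \<alpha>_\<alpha>'\<close>)

lemma mns_tld: "mns (tld R) = R" if "R \<in> Up"
  by (rule E_relation_eqI)
    (use Up_E[OF that] in \<open>auto simp: mem_tld mem_mns E_shift E_commute \<alpha>'_\<alpha>\<close>)

text \<open>Two negations cancel and the first coordinate becomes
  \<open>\<beta> (\<alpha> (\<beta> (\<alpha> x)))\<close>, which
  \<open>\<alpha>_\<beta>_\<alpha>\<close> reduces to
  \<open>\<beta> (\<beta> x) = x\<close>.\<close>

lemma ngt_ngt: "ngt (ngt R) = R" if "R \<in> Up"
  by (rule E_relation_eqI)
    (use Up_E[OF that] in \<open>auto simp: mem_ngt E_shift \<alpha>_\<beta>_\<alpha> \<beta>_\<beta> \<alpha>_X \<beta>_X\<close>)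

lemma ngt_join: "ngt (R \<union> S) = ngt R \<inter> ngt S"
  by (auto simp: mem_ngt)

text \<open>Both sides say that no \<open>x\<close>, \<open>y\<close>, \<open>z\<close> satisfy
  \<open>(x, y) \<in> R\<close>, \<open>(y, z) \<in> S\<close> and \<open>(x, z) \<notin> T\<close>:
  the \<alpha> introduced by \<open>mns\<close> is undone by the \<open>\<alpha>'\<close> of
  \<open>tld\<close>. \<open>residual_right\<close> is the mirror image.\<close>

lemma residual_left: "R O S \<subseteq> T \<longleftrightarrow> R \<subseteq> mns (S O tld T)"
  if "R \<in> Up" "S \<in> Up"
proof
  assume a: "R O S \<subseteq> T"
  show "R \<subseteq> mns (S O tld T)"
  proof (rule subrelI)
    fix x y assume xy: "(x, y) \<in> R"
    have "(x, z) \<in> T" if "(y, z) \<in> S" for z using a xy that by blast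
    moreover have "(x, y) \<in> E" "x \<in> X" using xy Up_E UpD_X \<open>R \<in> Up\<close> by blast+
    ultimately show "(x, y) \<in> mns (S O tld T)"
      by (auto simp: mem_mns mem_tld \<alpha>'_\<alpha>)
  qed
next
  assume a: "R \<subseteq> mns (S O tld T)"
  show "R O S \<subseteq> T"
  proof
    fix q assume "q \<in> R O S"
    then obtain x y z where q: "q = (x, z)" and xy: "(x, y) \<in> R" and yz: "(y, z) \<in> S" by blast
    have x: "x \<in> X" using xy UpD_X that by blast
    \<comment> \<open>A pair could miss \<open>tld T\<close> merely by lying outside
      \<open>E\<close>; excluding this, its absence forces \<open>(x, z)\<close> into
      \<open>T\<close>.\<close>
    have "(z, x) \<in> E" using xy yz Up_E that E_trans E_sym by blast
    moreover have "(z, \<alpha> x) \<notin> tld T" using a xy yz mem_mns by blast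
    ultimately show "q \<in> T" using x q by (simp add: mem_tld \<alpha>'_\<alpha> E_shift)
  qed
qed

lemma residual_right: "R O S \<subseteq> T \<longleftrightarrow> S \<subseteq> tld (mns T O R)"
  if "R \<in> Up" "S \<in> Up"
proof
  assume a: "R O S \<subseteq> T"
  show "S \<subseteq> tld (mns T O R)"
  proof (rule subrelI)
    fix x y assume xy: "(x, y) \<in> S"
    have "(z, y) \<in> T" if "(z, x) \<in> R" for z using a xy that by blast
    moreover have "(x, y) \<in> E" "y \<in> X" using xy Up_E UpD_X \<open>S \<in> Up\<close> by blast+
    ultimately show "(x, y) \<in> tld (mns T O R)"
      by (auto simp: mem_mns mem_tld \<alpha>_\<alpha>')
  qed
next
  assume a: "S \<subseteq> tld (mns T O R)"
  show "R O S \<subseteq> T"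
  proof
    fix q assume "q \<in> R O S"
    then obtain z x y where q: "q = (z, y)" and zx: "(z, x) \<in> R" and xy: "(x, y) \<in> S" by blast
    have y: "y \<in> X" using xy UpD_X that by blast
    have "(y, z) \<in> E" using zx xy Up_E that E_trans E_sym by blast
    moreover have "(\<alpha>' y, z) \<notin> mns T" using a xy zx mem_tld by blast
    ultimately show "q \<in> T" using y q by (simp add: mem_mns \<alpha>_\<alpha>' E_shift)
  qed
qed

text \<open>The right side is \<open>qplus\<close> of \<open>ngt R\<close> and \<open>ngt S\<close>.
  In \<open>mns (ngt S)\<close> the negations cancel and the coordinates swap, which accounts for
  the reversed factors. Intermediate points \<open>z\<close> on the right match points
  \<open>w = \<beta> (\<alpha> z)\<close> on the left.\<close>

lemma ngt_comp: "ngt (R O S) = tld (mns (ngt S) O mns (ngt R))"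
  if R: "R \<in> Up" and S: "S \<in> Up"
proof -
  have "(\<beta> (\<alpha> x), \<beta> y) \<in> R O S \<longleftrightarrow> (\<alpha>' y, x) \<in> mns (ngt S) O mns (ngt R)"
    if xy: "(x, y) \<in> E" for x y
  proof -
    have X: "x \<in> X" "y \<in> X" using xy E_left E_right by blast+
    have l: "(\<alpha>' y, z) \<in> mns (ngt S) \<longleftrightarrow> (\<beta> (\<alpha> z), \<beta> y) \<in> S" if "z \<in> X" for z
      using Up_E[OF S, of "\<beta> (\<alpha> z)" "\<beta> y"] X that
      by (auto simp: E_commute mem_mns mem_ngt E_shift \<alpha>_\<alpha>' \<alpha>_X)
    have r: "(z, x) \<in> mns (ngt R) \<longleftrightarrow> (\<beta> (\<alpha> x), \<beta> (\<alpha> z)) \<in> R" if "z \<in> X" for z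
      using Up_E[OF R, of "\<beta> (\<alpha> x)" "\<beta> (\<alpha> z)"] X that
      by (auto simp: E_commute mem_mns mem_ngt E_shift \<alpha>_X \<beta>_X)
    show ?thesis
    proof
      assume "(\<beta> (\<alpha> x), \<beta> y) \<in> R O S"
      then obtain w where w: "(\<beta> (\<alpha> x), w) \<in> R" "(w, \<beta> y) \<in> S" by blast
      then have wX: "w \<in> X" using UpD_X R by blast
      \<comment> \<open>Solving \<open>w = \<beta> (\<alpha> z)\<close> for \<open>z\<close> gives
        the witness.\<close>
      have "\<alpha>' (\<beta> w) \<in> X" "\<beta> (\<alpha> (\<alpha>' (\<beta> w))) = w"
        using wX by (simp_all add: \<alpha>'_X \<beta>_X \<alpha>_\<alpha>' \<beta>_\<beta>)
      then show "(\<alpha>' y, x) \<in> mns (ngt S) O mns (ngt R)" using w l r by (metis relcomp.relcompI)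
    next
      assume "(\<alpha>' y, x) \<in> mns (ngt S) O mns (ngt R)"
      then obtain z where z: "(\<alpha>' y, z) \<in> mns (ngt S)" "(z, x) \<in> mns (ngt R)" by blast
      then have "z \<in> X" using mem_mns E_right by blast
      then show "(\<beta> (\<alpha> x), \<beta> y) \<in> R O S" using z l r by blast
    qed
  qed
  then show ?thesis unfolding set_eq_iff split_paired_All mem_ngt mem_tld by metis
qed

section \<open>Assembling the distributive quasi relation algebra\<close>

lemma Dq_simps:
  "qcarrier (Dq X le E \<alpha> \<beta>) = Up"
  "qmeet (Dq X le E \<alpha> \<beta>) = (\<inter>)" "qjoin (Dq X le E \<alpha> \<beta>) = (\<union>)"
  "qmult (Dq X le E \<alpha> \<beta>) = (O)" "qone (Dq X le E \<alpha> \<beta>) = le"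
  "qtilde (Dq X le E \<alpha> \<beta>) = tld" "qminus (Dq X le E \<alpha> \<beta>) = mns" "qneg (Dq X le E \<alpha> \<beta>) = ngt"
  unfolding Dq_def tld_def mns_def ngt_def by auto

theorem DqRA_Dq: "DqRA (Dq X le E \<alpha> \<beta>)"
proof -
  let ?D = "Dq X le E \<alpha> \<beta>"
  have "qra_closed ?D"
    unfolding qra_closed_def Dq_simps
    by (simp add: le_Up meet_Up join_Up comp_Up tld_Up mns_Up ngt_Up)
  moreover have "qra_lattice ?D" unfolding qra_lattice_def Dq_simps by blast
  moreover have "qra_monoid ?D"
    unfolding qra_monoid_def Dq_simps by (simp add: le_comp comp_le O_assoc)
  moreover have qle: "qle ?D R S \<longleftrightarrow> R \<subseteq> S" for R S
    unfolding qle_def Dq_simps by blast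
  ultimately have "quasi_relation_algebra ?D"
    unfolding quasi_relation_algebra_def qplus_def qle
    unfolding Dq_simps
    \<comment> \<open>Read from right to left, the residuation lemmas turn both conditions into
      \<open>R O S \<subseteq> T\<close>, so the equivalences become trivial.\<close>
    by (simp add: residual_left[symmetric] residual_right[symmetric] tld_mns mns_tld ngt_ngt
        ngt_join ngt_comp)
  then show ?thesis unfolding DqRA_def Dq_simps by blast
qed

end

section \<open>The quotient data\<close>

text \<open>The class hypotheses translate every condition on classes into one on representatives.
  The order conditions then concern \<open>Q\<close>, and the remaining ones are inherited from
  \<open>X\<close>.\<close>

lemma Dq_data_quotient:
  assumes D: "Dq_data X le E \<alpha> \<beta>" and pre: "preorder_on X Q" and QE: "Q \<subseteq> E"
    and \<alpha>Q: "\<And>x y. x \<in> X \<Longrightarrow> y \<in> X \<Longrightarrow> (\<alpha> x, \<alpha> y) \<in> Q \<longleftrightarrow> (x, y) \<in> Q"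
    and \<beta>Q: "\<And>x y. x \<in> X \<Longrightarrow> y \<in> X \<Longrightarrow> (\<beta> y, \<beta> x) \<in> Q \<longleftrightarrow> (x, y) \<in> Q"
    and cl: "\<And>x y. x \<in> X \<Longrightarrow> y \<in> X \<Longrightarrow>
      eq_class Q x = eq_class Q y \<longleftrightarrow> (x, y) \<in> Q \<and> (y, x) \<in> Q"
    and clQ: "\<And>x y. x \<in> X \<Longrightarrow> y \<in> X \<Longrightarrow>
      (eq_class Q x, eq_class Q y) \<in> quot_rel Q Q \<longleftrightarrow> (x, y) \<in> Q"
    and clE: "\<And>x y. x \<in> X \<Longrightarrow> y \<in> X \<Longrightarrow>
      (eq_class Q x, eq_class Q y) \<in> quot_rel Q E \<longleftrightarrow> (x, y) \<in> E"
    and m\<alpha>: "\<And>x. x \<in> X \<Longrightarrow> quot_map Q \<alpha> (eq_class Q x) = eq_class Q (\<alpha> x)"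
    and m\<beta>: "\<And>x. x \<in> X \<Longrightarrow> quot_map Q \<beta> (eq_class Q x) = eq_class Q (\<beta> x)"
  shows "Dq_data (X // preorder_equiv Q) (quot_rel Q Q) (quot_rel Q E)
    (quot_map Q \<alpha>) (quot_map Q \<beta>)"
proof -
  interpret Dq_frame X le E \<alpha> \<beta> by unfold_locales (rule D)
  let ?c = "eq_class Q" and ?Y = "X // preorder_equiv Q"
  let ?a = "quot_map Q \<alpha>" and ?b = "quot_map Q \<beta>"
  have Y: "?Y = ?c ` X" unfolding quotient_def eq_class_def by blast
  have Qr: "\<And>x. x \<in> X \<Longrightarrow> (x, x) \<in> Q"
    and Qt: "\<And>x y z. (x, y) \<in> Q \<Longrightarrow> (y, z) \<in> Q \<Longrightarrow> (x, z) \<in> Q"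
    using pre unfolding preorder_on_def refl_on_def trans_def by blast+
  have EY: "quot_rel Q E \<subseteq> ?Y \<times> ?Y"
    unfolding Y quot_rel_def using E_left E_right by blast
  have QY: "quot_rel Q Q \<subseteq> quot_rel Q E" unfolding quot_rel_def using QE by blast
  have EYm: "C \<in> ?c ` X" "D \<in> ?c ` X" if "(C, D) \<in> quot_rel Q E" for C D
    using that EY Y by auto
  note QYm = EYm[OF subsetD[OF QY]]
  have bij: "bij_betw ?a ?Y ?Y" "bij_betw ?b ?Y ?Y"
  proof -
    have "inj_on ?a ?Y" "inj_on ?b ?Y"
      \<comment> \<open>Injectivity on classes needs the invariance of \<open>Q\<close> in the
        reflecting direction: equivalent images have equivalent arguments.\<close>
      by (auto simp: inj_on_def Y m\<alpha> m\<beta> cl \<alpha>_X \<beta>_X \<alpha>Q \<beta>Q)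
    moreover have "?a ` ?Y = ?c ` \<alpha> ` X" "?b ` ?Y = ?c ` \<beta> ` X"
      by (auto simp: Y m\<alpha> m\<beta> image_image)
    ultimately show "bij_betw ?a ?Y ?Y" "bij_betw ?b ?Y ?Y"
      using \<alpha>_bij \<beta>_bij unfolding bij_betw_def Y by simp_all
  qed
  have "partial_order_on ?Y (quot_rel Q Q)"
    unfolding partial_order_on_def preorder_on_def
  proof (intro conjI)
    show "refl_on ?Y (quot_rel Q Q)" using Qr by (auto simp: refl_on_def Y clQ)
    show "quot_rel Q Q \<subseteq> ?Y \<times> ?Y" using EY QY by blast
    show "trans (quot_rel Q Q)"
    proof (rule transI)
      fix B C D assume a: "(B, C) \<in> quot_rel Q Q" "(C, D) \<in> quot_rel Q Q"
      obtain x y z where "x \<in> X" "y \<in> X" "z \<in> X" "B = ?c x" "C = ?c y" "D = ?c z"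
        using QYm[OF a(1)] QYm[OF a(2)] by blast
      then show "(B, D) \<in> quot_rel Q Q" using a clQ Qt by metis
    qed
    show "antisym (quot_rel Q Q)"
    proof (rule antisymI)
      fix B C assume a: "(B, C) \<in> quot_rel Q Q" "(C, B) \<in> quot_rel Q Q"
      obtain x y where "x \<in> X" "y \<in> X" "B = ?c x" "C = ?c y"
        using QYm[OF a(1)] by blast
      \<comment> \<open>Antisymmetry holds because pairs related by \<open>Q\<close> both ways have
        been identified.\<close>
      then show "B = C" using a clQ cl by metis
    qed
  qed
  moreover have "equiv ?Y (quot_rel Q E)"
    unfolding equiv_def
  proof (intro conjI)
    show "refl_on ?Y (quot_rel Q E)" using E_refl by (auto simp: refl_on_def Y clE)
    show "quot_rel Q E \<subseteq> ?Y \<times> ?Y" by (rule EY)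
    show "sym (quot_rel Q E)" unfolding sym_def quot_rel_def using E_sym by blast
    show "trans (quot_rel Q E)"
    proof (rule transI)
      fix B C D assume a: "(B, C) \<in> quot_rel Q E" "(C, D) \<in> quot_rel Q E"
      obtain x y z where "x \<in> X" "y \<in> X" "z \<in> X" "B = ?c x" "C = ?c y" "D = ?c z"
        using EYm[OF a(1)] EYm[OF a(2)] by blast
      then show "(B, D) \<in> quot_rel Q E" using a clE E_trans by metis
    qed
  qed
  moreover have "order_automorphism ?Y (quot_rel Q Q) ?a"
    unfolding order_automorphism_def using bij by (auto simp: Y m\<alpha> clQ \<alpha>_X \<alpha>Q)
  moreover have "dual_order_automorphism ?Y (quot_rel Q Q) ?b"
    unfolding dual_order_automorphism_def using bij by (auto simp: Y m\<beta> clQ \<beta>_X \<beta>Q)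
  moreover have "\<forall>C\<in>?Y. ?b (?b C) = C" by (auto simp: Y m\<beta> \<beta>_X \<beta>_\<beta>)
  moreover have "fun_graph ?Y ?a \<subseteq> quot_rel Q E" "fun_graph ?Y ?b \<subseteq> quot_rel Q E"
    unfolding fun_graph_def by (auto simp: Y m\<alpha> m\<beta> clE \<alpha>_X \<beta>_X \<alpha>_E \<beta>_E)
  moreover have "fun_graph ?Y ?a O fun_graph ?Y ?b O fun_graph ?Y ?a = fun_graph ?Y ?b"
  proof -
    \<comment> \<open>The graphs are restricted to classes, so the pointwise identity gives the
      relational one only together with the fact that the intermediate values are classes.\<close>
    have "C \<in> ?Y \<Longrightarrow> ?a C \<in> ?Y \<and> ?b (?a C) \<in> ?Y \<and> ?a (?b (?a C)) = ?b C" for C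
      by (auto simp: Y m\<alpha> m\<beta> \<alpha>_X \<beta>_X \<alpha>_\<beta>_\<alpha>)
    then show ?thesis unfolding fun_graph_def relcomp_unfold by auto
  qed
  ultimately show ?thesis unfolding Dq_data_def using QY by blast
qed

theorem theorem3:
  fixes A :: "'a qra"
    and X :: "'x set" and le E :: "'x rel" and \<alpha> \<beta> :: "'x \<Rightarrow> 'x"
    and \<phi> :: "'a \<Rightarrow> 'x rel" and p :: 'a
  assumes "DqRA A"
    and "qra_representation A X le E \<alpha> \<beta> \<phi>"
    and "p \<in> qcarrier A"
    and "qra_positive A p" and "qra_symmetric A p" and "qra_idempotent A p"
  shows "DqRA (Dq (X // preorder_equiv (\<phi> p)) (quot_rel (\<phi> p) (\<phi> p)) (quot_rel (\<phi> p) E)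
           (quot_map (\<phi> p) \<alpha>) (quot_map (\<phi> p) \<beta>))"
proof (rule Dq_frame.DqRA_Dq, unfold_locales)
  have D: "Dq_data X le E \<alpha> \<beta>"
    using assms(2) unfolding qra_representation_def by blast
  have "qone A \<in> qcarrier A"
    using assms(1) unfolding DqRA_def quasi_relation_algebra_def qra_closed_def by blast
  \<comment> \<open>Invariance makes \<open>\<phi> p\<close> a preorder compatible with \<alpha> and
    \<beta>, and \<open>wd\<close> permits computing with representatives; these are the inputs of
    \<open>Dq_data_quotient\<close>.\<close>
  note inv = representation_invariance[OF assms(2-6) this]
  note wd = quot_well_defined[OF assms]
  show "Dq_data (X // preorder_equiv (\<phi> p)) (quot_rel (\<phi> p) (\<phi> p)) (quot_rel (\<phi> p) E)
      (quot_map (\<phi> p) \<alpha>) (quot_map (\<phi> p) \<beta>)"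
    by (rule Dq_data_quotient[OF D inv(1) inv(3) inv(4) inv(5) wd(1) wd(2) wd(3) wd(4) wd(5)])
qed

end
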